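(* Let $N_1\ge 1$ and $N_3\ge 0$ be fixed integers, let $c_0>0$ and $0<\rho^0<1/2$ be fixed real numbers, and for integers $N_2>c_0$ set $c=c_0/N_2$. For each such $N_2$ consider a positive decreasing solution of the stationary problem $\mathcal P(N_1,N_2,N_3,\rho^0,c)$ (defined in the context), and let $j^{(3)}=\rho^{(2)}_{N_2+N_3-1}$ be its exit flow. Then, as $N_2\to\infty$, $$\rho_n^{(1)}=\rho^0+O(N_2^{-1}),\qquad 0\le n\le N_1,$$ $$\rho_m^{(2)}=\rho_*\!\left(\rho^0,\tfrac{m}{N_2}\right)+O(N_2^{-1}),\qquad 0\le m\le N_2-\frac{\ln N_2}{\ln(1/\rho^0-1)},$$ $$j^{(1)}=\varphi(\rho^0)+O(N_2^{-1}),$$ $$j_m^{(2)}=\varphi\!\left(\rho_*\!\left(\rho^0,\tfrac{m}{N_2}\right)\right)+O(N_2^{-1}\ln N_2),\qquad 0\le m\le N_2$$ (for those $m$ for which $j^{(2)}_m$ is defined, i.e. $m\le N_2+N_3-1$), and $$j^{(3)}=\varphi\bigl(\rho_*(\rho^0,1)\bigr)+O(N_2^{-1}\ln N_2),$$ where $$\varphi(\rho)=\rho(1-\rho),\qquad \rho_*(\rho^0,\tau)=-\tfrac12\,W\!\left(-2\rho^0e^{-\rho^0(2+c_0\tau)}\right),$$ and $W:[-e^{-1},\infty)\to[-1,\infty)$ is the Lambert function, i.e. the inverse of $w\mapsto we^w$ on $[-1,\infty)$. Here $x_n=O(g(N_2))$ for a given range of the index means that there is a constant $C$ independent of $N_2$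 and of the index $n$ in the given range such that $|x_n|\le C\,g(N_2)$ for all sufficiently large $N_2$.
   Context: Definition (stationary problem $\mathcal P(N_1,N_2,N_3,\rho^0,c)$, for integers $N_1,N_2\ge1$, $N_3\ge0$, and $c\in(0,1)$). The unknowns are real numbers $\rho^{(1)}_0,\dots,\rho^{(1)}_{N_1}$; $\rho^{(2)}_0,\dots,\rho^{(2)}_{N_2+N_3}$; $R_0,\dots,R_{N_2+N_3}$; $j^{(1)}$; $j^{(2)}_0,\dots,j^{(2)}_{N_2+N_3-1}$; $J^{(2)}$. The equations are: (i) $\rho_{n+1}^{(1)}=1-\dfrac{j^{(1)}}{\rho_n^{(1)}}$ for $n=0,\ldots,N_1-1$; (ii) $R_{m+1}=1-\dfrac{J^{(2)}}{R_m}$ for $m=0,\ldots,N_2-1$, and $R_{m+1}=R_m$ for $m=N_2,\ldots,N_2+N_3-1$; (iii) $\rho_{m+1}^{(2)}=1-\dfrac{j_m^{(2)}}{\rho_m^{(2)}}$ for $m=0,\ldots,N_2+N_3-1$; (iv) $j_{m+1}^{(2)}=j_m^{(2)}-R_{m+1}\rho_m^{(2)}-(R_m-R_{m+2})\rho_{m+1}^{(2)}$ for $m=0,\ldots,N_2+N_3-2$; (v) boundary and matching conditions: $\rho_0^{(1)}=\rho^0$; $R_0=c\,\rho_{N_1}^{(1)}$; $\rho_0^{(2)}=(1-c)\rho_{N_1}^{(1)}$; $j^{(1)}=j_0^{(2)}+J^{(2)}-\rho_0^{(2)}R_1$; $R_{N_2}=0$; $\rho_{N_2+N_3}^{(2)}=0$.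 A solution is positive if $\rho_0^{(1)},\ldots,\rho_{N_1}^{(1)}$, $\rho_0^{(2)},\ldots,\rho_{N_2+N_3-1}^{(2)}$, $R_0,\ldots,R_{N_2-1}$, $j^{(1)}$, $j^{(2)}_0,\ldots,j^{(2)}_{N_2+N_3-1}$, $J^{(2)}$ are all $>0$. It is decreasing if $\rho^{(1)}_0>\cdots>\rho^{(1)}_{N_1}>\rho^{(2)}_0>\cdots>\rho^{(2)}_{N_2+N_3}=0$ and $R_0>\cdots>R_{N_2}=0$. The exit flow $j^{(3)}$ is the flow of first-kind particles from the last position, namely $\rho^{(2)}_{m}(1-\rho^{(2)}_{m+1}-R_{m+1})$ with $m=N_2+N_3-1$; since $\rho^{(2)}_{N_2+N_3}=R_{N_2+N_3}=0$, it equals $\rho^{(2)}_{N_2+N_3-1}$. *)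

theory Defs
  imports Complex_Main
begin

text \<open>
  The unknowns of the stationary problem. Sequences are functions on all of \<^typ>\<open>nat\<close>; only the
  values on the index ranges occurring in the predicates below are constrained. The boundary
  datum of the problem is called \<open>\<rho>0\<close>.
\<close>

record stationary_state =
  \<rho>1 :: "nat \<Rightarrow> real"
  \<rho>2 :: "nat \<Rightarrow> real"
  R :: "nat \<Rightarrow> real"
  j1 :: real
  j2 :: "nat \<Rightarrow> real"
  J2 :: real

text \<open>
  No non-vanishing of the denominators is required here; for positive solutions all of them are
  positive, so the convention \<open>x / 0 = 0\<close> plays no role.
\<close>

definition stationary_solution ::
  "nat \<Rightarrow> nat \<Rightarrow> nat \<Rightarrow> real \<Rightarrow> real \<Rightarrow> stationary_state \<Rightarrow> bool" where
  "stationary_solution N1 N2 N3 \<rho>0 c S \<longleftrightarrow>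
     (\<forall>n<N1. \<rho>1 S (n + 1) = 1 - j1 S / \<rho>1 S n) \<and>
     (\<forall>m<N2. R S (m + 1) = 1 - J2 S / R S m) \<and>
     (\<forall>m. N2 \<le> m \<and> m < N2 + N3 \<longrightarrow> R S (m + 1) = R S m) \<and>
     (\<forall>m<N2 + N3. \<rho>2 S (m + 1) = 1 - j2 S m / \<rho>2 S m) \<and>
     (\<forall>m. m + 2 \<le> N2 + N3 \<longrightarrow>
        j2 S (m + 1) = j2 S m - R S (m + 1) * \<rho>2 S m - (R S m - R S (m + 2)) * \<rho>2 S (m + 1)) \<and>
     \<rho>1 S 0 = \<rho>0 \<and>
     R S 0 = c * \<rho>1 S N1 \<and>
     \<rho>2 S 0 = (1 - c) * \<rho>1 S N1 \<and>
     j1 S = j2 S 0 + J2 S - \<rho>2 S 0 * R S 1 \<and>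
     R S N2 = 0 \<and>
     \<rho>2 S (N2 + N3) = 0"

definition positive_solution :: "nat \<Rightarrow> nat \<Rightarrow> nat \<Rightarrow> stationary_state \<Rightarrow> bool" where
  "positive_solution N1 N2 N3 S \<longleftrightarrow>
     (\<forall>n\<le>N1. 0 < \<rho>1 S n) \<and>
     (\<forall>m<N2 + N3. 0 < \<rho>2 S m) \<and>
     (\<forall>m<N2. 0 < R S m) \<and>
     0 < j1 S \<and>
     (\<forall>m<N2 + N3. 0 < j2 S m) \<and>
     0 < J2 S"

definition decreasing_solution :: "nat \<Rightarrow> nat \<Rightarrow> nat \<Rightarrow> stationary_state \<Rightarrow> bool" where
  "decreasing_solution N1 N2 N3 S \<longleftrightarrow>
     (\<forall>n<N1. \<rho>1 S (n + 1) < \<rho>1 S n) \<and>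
     \<rho>2 S 0 < \<rho>1 S N1 \<and>
     (\<forall>m<N2 + N3. \<rho>2 S (m + 1) < \<rho>2 S m) \<and>
     \<rho>2 S (N2 + N3) = 0 \<and>
     (\<forall>m<N2. R S (m + 1) < R S m) \<and>
     R S N2 = 0"

definition exit_flow :: "nat \<Rightarrow> nat \<Rightarrow> stationary_state \<Rightarrow> real" where
  "exit_flow N2 N3 S =
     (let m = N2 + N3 - 1 in \<rho>2 S m * (1 - \<rho>2 S (m + 1) - R S (m + 1)))"

lemma exit_flow_eq:
  assumes "stationary_solution N1 N2 N3 \<rho>0 c S" and "N2 \<ge> 1"
  shows "exit_flow N2 N3 S = \<rho>2 S (N2 + N3 - 1)"
proof -
  have base: "R S N2 = 0"
    and step: "\<And>m. N2 \<le> m \<Longrightarrow> m < N2 + N3 \<Longrightarrow> R S (m + 1) = R S m"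
    and end_zero: "\<rho>2 S (N2 + N3) = 0"
    using assms(1) unfolding stationary_solution_def by blast+
  have "k \<le> N3 \<Longrightarrow> R S (N2 + k) = 0" for k
  proof (induction k)
    case (Suc k)
    then show ?case using step[of "N2 + k"] by simp
  qed (simp add: base)
  then have "R S (N2 + N3) = 0" by simp
  with end_zero show ?thesis
    using assms(2) by (simp add: exit_flow_def Let_def)
qed

definition \<phi> :: "real \<Rightarrow> real" where
  "\<phi> \<rho> = \<rho> * (1 - \<rho>)"

text \<open>
  The principal branch of the Lambert function; meaningful for arguments \<open>\<ge> - exp (- 1)\<close>.
\<close>

definition lambert_W :: "real \<Rightarrow> real" where
  "lambert_W = inv_into {-1..} (\<lambda>w. w * exp w)"

lemma bij_betw_lambert:
  "bij_betw (\<lambda>w::real. w * exp w) {-1..} {- exp (- 1)..}"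
proof -
  have less: "x * exp x < y * exp y" if "-1 \<le> x" "x < y" for x y :: real
  proof -
    have "\<exists>D. ((\<lambda>w. w * exp w) has_real_derivative D) (at z) \<and> D > 0"
      if "x < z" "z < y" for z
    proof (intro exI conjI)
      show "((\<lambda>w. w * exp w) has_real_derivative (1 + z) * exp z) (at z)"
        by (auto intro!: derivative_eq_intros simp: algebra_simps)
      show "0 < (1 + z) * exp z"
        using that \<open>-1 \<le> x\<close> by (intro mult_pos_pos) auto
    qed
    moreover have "continuous_on {x..y} (\<lambda>w::real. w * exp w)"
      by (intro continuous_intros)
    ultimately show ?thesis
      by (rule DERIV_pos_imp_increasing_open[OF \<open>x < y\<close>])
  qed
  have "inj_on (\<lambda>w::real. w * exp w) {-1..}"
  proof (rule inj_onI, rule ccontr)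
    fix x y :: real
    assume "x \<in> {-1..}" "y \<in> {-1..}" "x * exp x = y * exp y" "x \<noteq> y"
    then show False
      using less[of x y] less[of y x] by (cases "x < y") simp_all
  qed
  moreover have "(\<lambda>w::real. w * exp w) ` {-1..} = {- exp (- 1)..}"
  proof (intro equalityI subsetI)
    fix y :: real
    assume "y \<in> (\<lambda>w. w * exp w) ` {-1..}"
    then obtain w where "-1 \<le> w" "y = w * exp w" by blast
    then show "y \<in> {- exp (- 1)..}"
      using less[of "-1" w] by (cases "w = -1") simp_all
  next
    fix y :: real
    assume y: "y \<in> {- exp (- 1)..}"
    have "\<bar>y\<bar> * 1 \<le> \<bar>y\<bar> * exp \<bar>y\<bar>"
      by (rule mult_left_mono) simp_all
    then have "y \<le> \<bar>y\<bar> * exp \<bar>y\<bar>" by linarith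
    moreover have "-1 \<le> \<bar>y\<bar>" by linarith
    moreover have "continuous_on {-1..\<bar>y\<bar>} (\<lambda>w::real. w * exp w)"
      by (intro continuous_intros)
    ultimately obtain w where "-1 \<le> w" "w * exp w = y"
      using IVT'[of "\<lambda>w. w * exp w" "-1" y "\<bar>y\<bar>"] y by auto
    then show "y \<in> (\<lambda>w. w * exp w) ` {-1..}"
      by (intro image_eqI[of _ _ w]) simp_all
  qed
  ultimately show ?thesis
    unfolding bij_betw_def by (rule conjI)
qed

definition \<rho>_star :: "real \<Rightarrow> real \<Rightarrow> real \<Rightarrow> real" where
  "\<rho>_star c0 \<rho>0 \<tau> = - (1 / 2) * lambert_W (- 2 * \<rho>0 * exp (- \<rho>0 * (2 + c0 * \<tau>)))"

end

theory Submission
  imports Defs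
begin

text \<open>
  Write \<open>x\<close> for \<open>\<rho>2\<close>, \<open>d m = x m - x (Suc m)\<close> and \<open>y m = \<rho>_star c0 \<rho>0 (m / N2)\<close>. Subtracting consecutive
  flow equations gives \<open>d m * (1 - x (Suc m)) = x (Suc m) * d (Suc m) + O(c)\<close>; as \<open>x \<le> \<rho>0 < 1 / 2\<close>, the
  differences decay geometrically away from the exit with ratio \<open>q = \<rho>0 / (1 - \<rho>0)\<close>, down to size
  \<open>O(c)\<close>. The same contraction in the first segment shows that \<open>\<rho>1\<close> is constant up to \<open>O(c)\<close>.
  Hence the flow \<open>j2 m = \<phi> (x m) + x m * d m\<close> loses \<open>c * \<rho>0 * x m + O(c\<^sup>2)\<close> per step, whereas
  \<open>\<phi> (y m)\<close> loses \<open>c * \<rho>0 * y m + O(c\<^sup>2)\<close>. Since \<open>\<phi>\<close> is bi-Lipschitz on \<open>[0, \<rho>0]\<close> and the boundary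
  layer \<open>q ^ (N2 - m)\<close> is summable, a discrete Gronwall argument bounds \<open>j2 m - \<phi> (y m)\<close> by \<open>O(c)\<close>
  for all \<open>m \<le> N2\<close>.
\<close>

section \<open>The limiting profile: \<open>\<phi>\<close>, \<open>ln x - 2 * x\<close> and the
  Lambert function\<close>

lemma \<phi>_diff: "\<phi> a - \<phi> b = (a - b) * (1 - a - b)"
  by (simp add: \<phi>_def algebra_simps)

text \<open>The function \<open>\<lambda>x. ln x - 2 * x\<close> is affine in \<open>\<tau>\<close> along \<open>\<rho>_star\<close>; its derivative is that of
  \<open>\<phi>\<close> divided by the argument.\<close>

lemma \<phi>_diff_eq_mean:
  assumes "0 < b" "b < a" "a \<le> 1 / 2"
  shows "\<exists>\<xi>. b < \<xi> \<and> \<xi> < a \<and> \<phi> a - \<phi> b = \<xi> * ((ln a - 2 * a) - (ln b - 2 * b))"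
proof -
  have "\<exists>\<xi>. b < \<xi> \<and> \<xi> < a \<and>
      ((ln a - 2 * a) - (ln b - 2 * b)) * (1 - 2 * \<xi>) = (\<phi> a - \<phi> b) * (1 / \<xi> - 2)"
  proof (rule GMVT'[OF \<open>b < a\<close>])
    fix z assume z: "b < z" "z < a"
    show "(\<phi> has_real_derivative 1 - 2 * z) (at z)"
      unfolding \<phi>_def[abs_def] by (auto intro!: derivative_eq_intros)
    show "((\<lambda>x. ln x - 2 * x) has_real_derivative 1 / z - 2) (at z)"
      using z \<open>0 < b\<close> by (auto intro!: derivative_eq_intros)
  next
    fix z assume "b \<le> z" "z \<le> a"
    then show "isCont \<phi> z" "isCont (\<lambda>x. ln x - 2 * x) z"
      using \<open>0 < b\<close> unfolding \<phi>_def[abs_def] by (auto intro!: continuous_intros)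
  qed
  then obtain \<xi> where \<xi>: "b < \<xi>" "\<xi> < a"
    and eq: "((ln a - 2 * a) - (ln b - 2 * b)) * (1 - 2 * \<xi>) = (\<phi> a - \<phi> b) * (1 / \<xi> - 2)"
    by blast
  \<comment> \<open>The strict bound \<open>\<xi> < a\<close> lets the common factor
    \<open>1 - 2 * \<xi>\<close> be cancelled even for \<open>a = 1 / 2\<close>.\<close>
  have "\<xi> > 0" "1 - 2 * \<xi> \<noteq> 0" using \<xi> assms by auto
  then have "1 / \<xi> - 2 = (1 - 2 * \<xi>) / \<xi>" by (simp add: field_simps)
  with eq have *: "(1 - 2 * \<xi>) * ((ln a - 2 * a) - (ln b - 2 * b)) = (1 - 2 * \<xi>) * ((\<phi> a - \<phi> b) / \<xi>)"
    by (simp add: mult.commute)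
  have "(ln a - 2 * a) - (ln b - 2 * b) = (\<phi> a - \<phi> b) / \<xi>"
    using * unfolding mult_left_cancel[OF \<open>1 - 2 * \<xi> \<noteq> 0\<close>] .
  with \<open>\<xi> > 0\<close> \<xi> show ?thesis by (intro exI[of _ \<xi>]) simp
qed

text \<open>Turns comparisons of the right-hand sides of the implicit equation for
  \<open>\<rho>_star\<close> into comparisons of densities.\<close>

lemma ln_minus_double_less:
  fixes a b :: real
  assumes "0 < b" "b < a" "a \<le> 1 / 2"
  shows "ln b - 2 * b < ln a - 2 * a"
proof -
  obtain \<xi> where \<xi>: "b < \<xi>" "\<phi> a - \<phi> b = \<xi> * ((ln a - 2 * a) - (ln b - 2 * b))"
    using \<phi>_diff_eq_mean[OF assms] by blast
  have "0 < \<phi> a - \<phi> b" unfolding \<phi>_diff using assms by (intro mult_pos_pos) auto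
  with \<xi> assms show ?thesis by (simp add: zero_less_mult_iff)
qed

text \<open>With \<open>w = - 2 * y\<close> the Lambert equation reads \<open>y * exp (- 2 * y) =
  \<rho>0 * exp (- \<rho>0 * (2 + c0 * \<tau>))\<close>; its logarithm is the implicit equation. The
  branch condition \<open>-1 \<le> w\<close> means \<open>y \<le> 1 / 2\<close>, where
  \<open>ln_minus_double_less\<close> applies.\<close>

lemma \<rho>_star_props:
  assumes "0 < \<rho>0" "\<rho>0 < 1 / 2" "0 \<le> c0 * \<tau>"
  shows "0 < \<rho>_star c0 \<rho>0 \<tau>" "\<rho>_star c0 \<rho>0 \<tau> \<le> \<rho>0"
    and "ln (\<rho>_star c0 \<rho>0 \<tau>) - 2 * \<rho>_star c0 \<rho>0 \<tau> = ln \<rho>0 - 2 * \<rho>0 - c0 * \<rho>0 * \<tau>"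
proof -
  define z where "z = - 2 * \<rho>0 * exp (- \<rho>0 * (2 + c0 * \<tau>))"
  define w where "w = lambert_W z"
  define y where "y = \<rho>_star c0 \<rho>0 \<tau>"
  have y: "y = - (1 / 2) * w" by (simp add: y_def \<rho>_star_def w_def z_def)
  \<comment> \<open>This is the argument of \<open>lambert_W\<close> for
    \<open>c0 * \<tau> = 0\<close>, attained at \<open>w = - 2 * \<rho>0 > -1\<close>; a larger
    \<open>c0 * \<tau>\<close> only moves it towards 0, so it stays in the domain.\<close>
  have "- 2 * \<rho>0 * exp (- 2 * \<rho>0) \<in> {- exp (- 1)..}"
    unfolding bij_betw_imp_surj_on[OF bij_betw_lambert, symmetric]
    using assms(2) by (intro image_eqI[of _ _ "- 2 * \<rho>0"]) auto
  moreover have "2 * \<rho>0 * exp (- \<rho>0 * (2 + c0 * \<tau>)) \<le> 2 * \<rho>0 * exp (- 2 * \<rho>0)"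
    using assms mult_nonneg_nonneg[of \<rho>0 "c0 * \<tau>"] by (intro mult_left_mono) (auto simp: algebra_simps)
  ultimately have "z \<in> {- exp (- 1)..}" by (simp add: z_def)
  then have zi: "z \<in> (\<lambda>w. w * exp w) ` {-1..}"
    using bij_betw_imp_surj_on[OF bij_betw_lambert] by simp
  have w1: "w * exp w = z" and w2: "-1 \<le> w"
    using f_inv_into_f[OF zi] inv_into_into[OF zi] by (simp_all add: w_def lambert_W_def)
  have "z < 0" using assms by (simp add: z_def)
  with w1 have "w < 0" by (metis exp_gt_zero mult_less_0_iff not_less_iff_gr_or_eq)
  then have y0: "0 < y" and y2: "y \<le> 1 / 2" using y w2 by auto
  have "y * exp (- 2 * y) = \<rho>0 * exp (- \<rho>0 * (2 + c0 * \<tau>))"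
    using w1 y by (simp add: z_def)
  then have "ln (y * exp (- 2 * y)) = ln (\<rho>0 * exp (- \<rho>0 * (2 + c0 * \<tau>)))" by simp
  then have eq: "ln y - 2 * y = ln \<rho>0 - 2 * \<rho>0 - c0 * \<rho>0 * \<tau>"
    using y0 assms(1) by (simp add: ln_mult algebra_simps)
  have "0 \<le> c0 * \<rho>0 * \<tau>" using assms mult_nonneg_nonneg[of \<rho>0 "c0 * \<tau>"] by (simp add: algebra_simps)
  then have "y \<le> \<rho>0"
    using ln_minus_double_less[of \<rho>0 y] eq y2 assms by fastforce
  with y0 eq show "0 < \<rho>_star c0 \<rho>0 \<tau>" "\<rho>_star c0 \<rho>0 \<tau> \<le> \<rho>0"
    "ln (\<rho>_star c0 \<rho>0 \<tau>) - 2 * \<rho>_star c0 \<rho>0 \<tau> = ln \<rho>0 - 2 * \<rho>0 - c0 * \<rho>0 * \<tau>"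
    by (simp_all add: y_def)
qed

lemma \<rho>_star_0:
  assumes "0 < \<rho>0" "\<rho>0 < 1 / 2"
  shows "\<rho>_star c0 \<rho>0 0 = \<rho>0"
  using \<rho>_star_props[OF assms, of c0 0] ln_minus_double_less[of "\<rho>_star c0 \<rho>0 0" \<rho>0] assms
  by fastforce

text \<open>Discrete form of the differential equation by which
  \<open>\<phi> (\<rho>_star c0 \<rho>0 \<tau>)\<close> decreases at rate
  \<open>c0 * \<rho>0 * \<rho>_star c0 \<rho>0 \<tau>\<close>. The mean value point lies between
  \<open>b\<close> and \<open>a\<close>, and \<open>a - b\<close> is of order \<open>h\<close>, so
  the error is quadratic in \<open>h\<close>.\<close>

lemma \<rho>_star_increment:
  assumes \<rho>0: "0 < \<rho>0" "\<rho>0 < 1 / 2" and "0 < c0" "0 \<le> \<tau>" "\<tau> < \<tau>'"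
  defines "a \<equiv> \<rho>_star c0 \<rho>0 \<tau>" and "b \<equiv> \<rho>_star c0 \<rho>0 \<tau>'"
    and "h \<equiv> c0 * \<rho>0 * (\<tau>' - \<tau>)"
  shows "0 \<le> \<phi> a - \<phi> b" "\<phi> a - \<phi> b \<le> h" "\<bar>\<phi> a - \<phi> b - h * a\<bar> \<le> h * (h / (1 - 2 * \<rho>0))"
proof -
  have a: "0 < a" "a \<le> \<rho>0" "ln a - 2 * a = ln \<rho>0 - 2 * \<rho>0 - c0 * \<rho>0 * \<tau>"
    unfolding a_def using \<rho>_star_props[of \<rho>0 c0 \<tau>] assms by auto
  have b: "0 < b" "b \<le> \<rho>0" "ln b - 2 * b = ln \<rho>0 - 2 * \<rho>0 - c0 * \<rho>0 * \<tau>'"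
    unfolding b_def using \<rho>_star_props[of \<rho>0 c0 \<tau>'] assms by auto
  have h: "0 < h" and Gh: "(ln a - 2 * a) - (ln b - 2 * b) = h"
    using a b assms by (auto simp: algebra_simps)
  have "b < a"
  proof (rule ccontr)
    assume "\<not> b < a"
    then consider "a = b" | "a < b" by linarith
    then show False
    proof cases
      case 1 then show False using Gh h by simp
    next
      case 2 then show False using ln_minus_double_less[of a b] a(1) b(2) \<rho>0(2) Gh h by simp
    qed
  qed
  then obtain \<xi> where \<xi>: "b < \<xi>" "\<xi> < a" and eq: "\<phi> a - \<phi> b = \<xi> * h"
    using \<phi>_diff_eq_mean[of b a] a b assms Gh by auto
  show "0 \<le> \<phi> a - \<phi> b" using eq \<xi> b h by simp
  have \<xi>1: "\<xi> \<le> 1" using \<xi> a assms by simp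
  show le: "\<phi> a - \<phi> b \<le> h" using eq \<xi>1 h by simp
  have "(a - b) * (1 - 2 * \<rho>0) \<le> (a - b) * (1 - a - b)"
    using \<open>b < a\<close> a b by (intro mult_left_mono) auto
  also have "\<dots> \<le> h" using le \<phi>_diff by simp
  finally have "a - b \<le> h / (1 - 2 * \<rho>0)" using assms by (simp add: field_simps)
  then have "\<bar>\<xi> - a\<bar> \<le> h / (1 - 2 * \<rho>0)" using \<xi> by simp
  moreover have "\<phi> a - \<phi> b - h * a = h * (\<xi> - a)" using eq by (simp add: algebra_simps)
  ultimately show "\<bar>\<phi> a - \<phi> b - h * a\<bar> \<le> h * (h / (1 - 2 * \<rho>0))"
    using h mult_left_mono[of "\<bar>\<xi> - a\<bar>" "h / (1 - 2 * \<rho>0)" h] by (simp add: abs_mult)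
qed

section \<open>Setting, flow equations and elementary bounds\<close>

lemma recurrence_imp_flow: "v = 1 - j / u \<Longrightarrow> 0 < u \<Longrightarrow> j = u * (1 - v)" for u v j :: real
  by simp

locale decreasing_profile =
  fixes N1 N2 N3 :: nat and c0 c \<rho>0 :: real and S :: stationary_state
  assumes N1: "1 \<le> N1" and c0: "0 < c0" and c: "c = c0 / real N2" and c0_less: "c0 < real N2"
    and \<rho>0: "0 < \<rho>0" "\<rho>0 < 1 / 2"
    and stationary: "stationary_solution N1 N2 N3 \<rho>0 c S"
    and positive: "positive_solution N1 N2 N3 S"
    and decreasing: "decreasing_solution N1 N2 N3 S"
begin

text \<open>\<open>Q\<close> is the sum of all powers of \<open>q\<close>. These and the later
  constants \<open>D\<close>, \<open>\<kappa>\<close>, \<open>L\<close>, \<open>B\<close>,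
  \<open>A\<close>, \<open>K\<close> depend only on \<open>N1\<close>, \<open>c0\<close> and
  \<open>\<rho>0\<close>, which makes the final bounds uniform in \<open>N2\<close>.\<close>

definition q where "q = \<rho>0 / (1 - \<rho>0)"
definition Q where "Q = 1 / (1 - q)"
definition D where "D = Q / c0 + Q + 2"

abbreviation "x \<equiv> \<rho>2 S"
abbreviation "d m \<equiv> x m - x (Suc m)"
abbreviation "\<rho>end \<equiv> \<rho>1 S N1"

lemma N2_pos: "0 < N2" using c0 c0_less by (cases N2) auto
lemma c_pos: "0 < c" using N2_pos c c0 by simp
lemma c_less: "c < 1" using N2_pos c c0_less by simp
lemma c_N2: "c * real N2 = c0" using N2_pos c by simp

lemma q: "0 < q" "q < 1"
  using \<rho>0 by (auto simp: q_def)

lemma Q: "1 \<le> Q" "q * Q + 1 = Q"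
  using q by (auto simp: Q_def field_simps)

text \<open>\<open>q ^ (N2 - 1)\<close> is the smallest of \<open>N2\<close> terms of a geometric
  sum bounded by \<open>Q\<close>, hence at most \<open>Q / N2\<close>.\<close>

lemma q_power_le: "q ^ (N2 - 1) \<le> Q / c0 * c"
proof -
  have "real (n + 1) * q ^ n \<le> (\<Sum>i\<le>n. q ^ i)" for n
  proof -
    have "(\<Sum>i\<le>n. q ^ n) \<le> (\<Sum>i\<le>n. q ^ i)"
      using q by (intro sum_mono power_decreasing) auto
    then show ?thesis by simp
  qed
  also have "(\<Sum>i\<le>n. q ^ i) \<le> Q" for n
    using q by (simp add: sum_gp0 Q_def divide_simps)
  finally have "real (N2 - 1 + 1) * q ^ (N2 - 1) \<le> Q" .
  then have "q ^ (N2 - 1) \<le> Q / real N2" using N2_pos by (simp add: pos_le_divide_eq mult.commute)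
  then show ?thesis using c c0 by simp
qed

lemma q_power_shift: "m < N2 \<Longrightarrow> q ^ (N2 - m) = q * q ^ (N2 - 1 - m)"
  by (simp add: Suc_diff_Suc flip: power_Suc)

lemma \<rho>1_Suc: "n < N1 \<Longrightarrow> j1 S = \<rho>1 S n * (1 - \<rho>1 S (Suc n))"
  using stationary positive unfolding stationary_solution_def positive_solution_def
  by (intro recurrence_imp_flow) auto

lemma R_Suc: "m < N2 \<Longrightarrow> J2 S = R S m * (1 - R S (Suc m))"
  using stationary positive unfolding stationary_solution_def positive_solution_def
  by (intro recurrence_imp_flow) auto

lemma x_Suc: "m < N2 + N3 \<Longrightarrow> j2 S m = x m * (1 - x (Suc m))"
  using stationary positive unfolding stationary_solution_def positive_solution_def
  by (intro recurrence_imp_flow) auto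

lemma boundary:
  "\<rho>1 S 0 = \<rho>0" "R S 0 = c * \<rho>end" "x 0 = (1 - c) * \<rho>end"
  "j1 S = j2 S 0 + J2 S - x 0 * R S 1" "R S N2 = 0" "x (N2 + N3) = 0"
  using stationary unfolding stationary_solution_def by auto

lemma \<rho>1_Suc_less: "n < N1 \<Longrightarrow> \<rho>1 S (Suc n) < \<rho>1 S n"
  using decreasing unfolding decreasing_solution_def by auto

lemma \<rho>1_bounds: "n \<le> N1 \<Longrightarrow> 0 < \<rho>1 S n \<and> \<rho>1 S n \<le> \<rho>0"
proof (induction n)
  case 0 then show ?case using \<rho>0 boundary by simp
next
  case (Suc n)
  moreover have "0 < \<rho>1 S (Suc n)" using positive Suc.prems unfolding positive_solution_def by auto
  ultimately show ?case using \<rho>1_Suc_less[of n] by auto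
qed

lemma \<rho>end: "0 < \<rho>end" "\<rho>end \<le> \<rho>0"
  using \<rho>1_bounds by auto

lemma d_pos: "m < N2 + N3 \<Longrightarrow> 0 < d m"
  using decreasing unfolding decreasing_solution_def by auto

lemma x_bounds: "m \<le> N2 + N3 \<Longrightarrow> 0 \<le> x m \<and> x m \<le> \<rho>0"
proof (induction m)
  case 0
  have "(1 - c) * \<rho>end \<le> 1 * \<rho>end" "0 \<le> (1 - c) * \<rho>end"
    using c_pos c_less \<rho>end by (intro mult_right_mono mult_nonneg_nonneg; simp)+
  then show ?case using boundary(3) \<rho>end by linarith
next
  case (Suc m)
  have "0 \<le> x (Suc m)"
    using positive boundary Suc.prems unfolding positive_solution_def
    by (cases "Suc m = N2 + N3") (auto simp: less_imp_le)
  then show ?case using Suc d_pos[of m] by auto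
qed

section \<open>Size and monotonicity of \<open>R\<close>\<close>

lemma R_beyond: "N2 \<le> m \<Longrightarrow> m \<le> N2 + N3 \<Longrightarrow> R S m = 0"
proof (induction rule: dec_induct)
  case base show ?case by (rule boundary)
next
  case (step m)
  then show ?case using stationary unfolding stationary_solution_def by auto
qed

lemma R_antimono: "m \<le> n \<Longrightarrow> n \<le> N2 \<Longrightarrow> R S n \<le> R S m"
proof (induction rule: dec_induct)
  case (step n)
  have "R S (Suc n) < R S n"
    using decreasing step.prems unfolding decreasing_solution_def by auto
  then show ?case using step by simp
qed simp

lemma R_bounds: "m \<le> N2 + N3 \<Longrightarrow> 0 \<le> R S m \<and> R S m \<le> c / 2"
proof -
  have "R S 0 \<le> c / 2" using boundary \<rho>end \<rho>0 c_pos by (simp add: mult_le_cancel_left)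
  moreover assume "m \<le> N2 + N3"
  ultimately show ?thesis
    using R_beyond[of m] R_antimono[of 0 m] R_antimono[of m N2] boundary(5) c_pos
    by (cases "m \<le> N2") auto
qed

text \<open>Since \<open>R\<close> is small, \<open>R m * (1 - R (Suc m)) = J2\<close> forces \<open>R\<close> to be almost constant up to
  position \<open>N2 - 1\<close>, from where it drops to \<open>0\<close>.\<close>

lemma R_plateau:
  assumes "m < N2"
  shows "R S m \<le> c * \<rho>end" "c * \<rho>end - c\<^sup>2 \<le> R S m"
proof -
  show "R S m \<le> c * \<rho>end" using R_antimono[of 0 m] assms boundary by simp
  have "R S 0 * R S (Suc 0) \<le> c * c"
    using R_bounds[of 0] R_bounds[of "Suc 0"] N2_pos c_pos by (intro mult_mono) auto
  moreover have "R S 0 * (1 - R S (Suc 0)) = R S m * (1 - R S (Suc m))"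
    using R_Suc[OF assms] R_Suc[OF N2_pos] by simp
  moreover have "0 \<le> R S m * R S (Suc m)"
    using R_bounds[of m] R_bounds[of "Suc m"] assms by (intro mult_nonneg_nonneg) auto
  ultimately show "c * \<rho>end - c\<^sup>2 \<le> R S m"
    using boundary by (simp add: algebra_simps power2_eq_square)
qed

section \<open>Flow loss per step and geometric decay of the differences \<open>d\<close>\<close>

definition \<delta> where
  "\<delta> m = R S (Suc m) * x m + (R S m - R S (Suc (Suc m))) * x (Suc m)"

lemma j2_Suc: "Suc m < N2 + N3 \<Longrightarrow> j2 S (Suc m) = j2 S m - \<delta> m"
  using stationary unfolding stationary_solution_def \<delta>_def by auto

lemma R_step2: "m + 2 \<le> N2 + N3 \<Longrightarrow> R S (Suc (Suc m)) \<le> R S m"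
  using R_antimono[of m "Suc (Suc m)"] R_beyond[of "Suc (Suc m)"] R_bounds[of m]
  by (cases "m + 2 \<le> N2") auto

text \<open>Crude, but valid also across the drop of \<open>R\<close> at \<open>N2\<close>, where
  the sharper \<open>\<delta>_near\<close> does not apply.\<close>

lemma \<delta>_bounds:
  assumes "Suc m < N2 + N3"
  shows "0 \<le> \<delta> m" "\<delta> m \<le> c / 2"
proof -
  note b = R_bounds[of m] R_bounds[of "Suc m"] R_bounds[of "Suc (Suc m)"] R_step2[of m]
    x_bounds[of m] x_bounds[of "Suc m"]
  show "0 \<le> \<delta> m"
    unfolding \<delta>_def using b assms by (intro add_nonneg_nonneg mult_nonneg_nonneg) auto
  have "R S (Suc m) * x m \<le> c / 2 * (1 / 2)"
    using b assms \<rho>0 by (intro mult_mono) auto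
  moreover have "(R S m - R S (Suc (Suc m))) * x (Suc m) \<le> c / 2 * (1 / 2)"
    using b assms \<rho>0 by (intro mult_mono) auto
  ultimately show "\<delta> m \<le> c / 2" unfolding \<delta>_def by simp
qed

text \<open>\<open>u / (1 - u)\<close> increases with \<open>u\<close> and equals \<open>q\<close>
  at \<open>\<rho>0\<close>.\<close>

lemma x_ratio: assumes "0 \<le> u" "u \<le> \<rho>0" shows "u \<le> q * (1 - u)"
proof -
  have "u * (1 - \<rho>0) \<le> \<rho>0 * (1 - u)" using assms by (simp add: algebra_simps)
  then have "u \<le> \<rho>0 * (1 - u) / (1 - \<rho>0)" using \<rho>0 by (subst pos_le_divide_eq) auto
  then show ?thesis by (simp add: q_def)
qed

lemma d_step:
  assumes "Suc m < N2 + N3"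
  shows "d m \<le> q * d (Suc m) + c"
proof -
  let ?u = "x (Suc m)"
  have u: "0 \<le> ?u" "?u \<le> \<rho>0" using x_bounds[of "Suc m"] assms by auto
  have "d m * (1 - ?u) = ?u * d (Suc m) + \<delta> m"
    using j2_Suc[OF assms] x_Suc[of m] x_Suc[of "Suc m"] assms by (simp add: algebra_simps)
  also have "\<dots> \<le> q * (1 - ?u) * d (Suc m) + c * (1 - ?u)"
  proof (intro add_mono mult_right_mono x_ratio u)
    show "0 \<le> d (Suc m)" using d_pos[OF assms] by simp
    have "c * (1 / 2) \<le> c * (1 - ?u)" using u \<rho>0 c_pos by (intro mult_left_mono) auto
    then show "\<delta> m \<le> c * (1 - ?u)" using \<delta>_bounds[OF assms] by simp
  qed
  also have "\<dots> = (q * d (Suc m) + c) * (1 - ?u)" by (simp add: algebra_simps)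
  finally show ?thesis by (rule mult_right_le_imp_le) (use u \<rho>0 in simp)
qed

text \<open>Backward induction from the exit, where the difference is at most 1.
  \<open>Q * c\<close> is the fixed point of \<open>t \<mapsto> q * t + c\<close>, so the source
  terms \<open>c\<close> never accumulate beyond it.\<close>

lemma d_le: "m < N2 + N3 \<Longrightarrow> d m \<le> q ^ (N2 + N3 - 1 - m) + Q * c"
proof (induction "N2 + N3 - 1 - m" arbitrary: m)
  case 0
  then have "Suc m = N2 + N3" "m \<le> N2 + N3" by auto
  then have "d m \<le> 1" using x_bounds[of m] boundary \<rho>0 by simp
  then show ?case using 0 Q c_pos by (simp add: add_increasing2)
next
  case (Suc k)
  then have m: "Suc m < N2 + N3" and k: "k = N2 + N3 - 1 - Suc m" by auto
  have "d m \<le> q * d (Suc m) + c" using d_step[OF m] .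
  also have "\<dots> \<le> q * (q ^ k + Q * c) + c"
    using Suc.hyps(1)[OF k m] q k by (intro add_mono mult_left_mono) auto
  also have "\<dots> = q ^ Suc k + (q * Q + 1) * c" by (simp add: algebra_simps)
  finally show ?case using Suc.hyps(2) Q(2) by simp
qed

text \<open>Measures the layer from \<open>N2\<close>, uniformly in \<open>N3\<close>. For
  \<open>m \<ge> N2 - 1\<close> truncated subtraction makes the power equal to 1.\<close>

lemma d_le': assumes "m < N2 + N3" shows "d m \<le> q ^ (N2 - 1 - m) + Q * c"
proof -
  have "q ^ (N2 + N3 - 1 - m) \<le> q ^ (N2 - 1 - m)"
    using q by (intro power_decreasing) auto
  then show ?thesis using d_le[OF assms] by simp
qed

section \<open>The junction and the first segment\<close>

lemma d_0_le: "d 0 \<le> (Q / c0 + Q) * c"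
  using d_le'[of 0] q_power_le N2_pos by (simp add: algebra_simps)

text \<open>The matching conditions take the form of one more flow equation of the first segment,
  with \<open>(1 - c) * x 1 + R S 1\<close> as the density behind the junction.\<close>

lemma j1_eq: "j1 S = \<rho>end * (1 - (1 - c) * x 1 - R S 1)"
proof -
  have "j1 S = x 0 * (1 - x 1) + R S 0 * (1 - R S 1) - x 0 * R S 1"
    using boundary(4) x_Suc[of 0] R_Suc[of 0] N2_pos by simp
  then show ?thesis unfolding boundary(2,3) by (simp add: algebra_simps)
qed

text \<open>Backward induction from the junction: as densities are below 1/2, the ratio
  \<open>u / (1 - u)\<close> is below 1 and the differences do not grow towards the
  entrance.\<close>

lemma \<rho>1_diff_le: "n < N1 \<Longrightarrow> \<rho>1 S n - \<rho>1 S (Suc n) \<le> D * c"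
proof (induction "N1 - 1 - n" arbitrary: n)
  case 0
  then have n: "Suc n = N1" by simp
  have u: "0 < \<rho>end" "\<rho>end < 1 / 2" using \<rho>end \<rho>0 by auto
  have "(\<rho>1 S n - \<rho>1 S (Suc n)) * (1 - \<rho>end) = \<rho>end * (\<rho>end - (1 - c) * x 1 - R S 1)"
    using \<rho>1_Suc[OF 0(2)] j1_eq n by (simp add: algebra_simps)
  also have "\<dots> \<le> \<rho>end * (D * c)"
  proof (rule mult_left_mono)
    have "\<rho>end - (1 - c) * x 1 - R S 1 \<le> \<rho>end - (1 - c) * x 1"
      using R_bounds[of 1] N2_pos by simp
    \<comment> \<open>By \<open>x 0 = (1 - c) * \<rho>end\<close> the drop across the junction is
      \<open>d 0\<close> plus two terms of size \<open>c\<close>; this is the origin of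
      \<open>D\<close>.\<close>
    also have "\<dots> = c * \<rho>end + d 0 + c * x 1" using boundary by (simp add: algebra_simps)
    also have "\<dots> \<le> c * 1 + (Q / c0 + Q) * c + c * 1"
      using x_bounds[of 1] N2_pos u \<rho>0 c_pos d_0_le by (intro add_mono mult_left_mono) auto
    also have "\<dots> = D * c" by (simp add: D_def algebra_simps)
    finally show "\<rho>end - (1 - c) * x 1 - R S 1 \<le> D * c" .
  qed (use u in simp)
  also have "\<dots> \<le> D * c * (1 - \<rho>end)"
    unfolding mult.commute[of \<rho>end] using u Q c0 c_pos by (intro mult_left_mono) (auto simp: D_def)
  finally show ?case unfolding n by (rule mult_right_le_imp_le) (use u in simp)
next
  case (Suc k)
  then have n: "Suc n < N1" "k = N1 - 1 - Suc n" by auto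
  let ?u = "\<rho>1 S (Suc n)" and ?e = "\<rho>1 S (Suc n) - \<rho>1 S (Suc (Suc n))"
  have u: "0 < ?u" "?u < 1 / 2" using \<rho>1_bounds[of "Suc n"] n \<rho>0 by auto
  have e: "0 < ?e" using \<rho>1_Suc_less[OF n(1)] by simp
  have "(\<rho>1 S n - ?u) * (1 - ?u) = ?u * ?e"
    using \<rho>1_Suc[of n] \<rho>1_Suc[of "Suc n"] n by (simp add: algebra_simps)
  also have "\<dots> \<le> ?e * (1 - ?u)"
    unfolding mult.commute[of ?u] using u e by (intro mult_left_mono) auto
  finally have "\<rho>1 S n - ?u \<le> ?e" by (rule mult_right_le_imp_le) (use u in simp)
  then show ?case using Suc.hyps(1)[OF n(2,1)] by simp
qed

lemma D_pos: "0 < D" using Q c0 by (simp add: D_def add_nonneg_pos)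

lemma \<rho>1_near: "n \<le> N1 \<Longrightarrow> \<bar>\<rho>1 S n - \<rho>0\<bar> \<le> N1 * D * c"
proof -
  have "n \<le> N1 \<Longrightarrow> \<rho>0 - \<rho>1 S n \<le> n * (D * c)"
  proof (induction n)
    case 0 then show ?case using boundary by simp
  next
    case (Suc n)
    then show ?case using \<rho>1_diff_le[of n] by (simp add: algebra_simps)
  qed
  moreover assume n: "n \<le> N1"
  moreover have "n * (D * c) \<le> N1 * (D * c)" using n D_pos c_pos by (intro mult_right_mono) auto
  ultimately show ?thesis using \<rho>1_bounds[OF n] by (simp add: mult.assoc)
qed

lemma j1_near: "\<bar>j1 S - \<phi> \<rho>0\<bar> \<le> N1 * D * c"
proof -
  have "j1 S - \<phi> \<rho>0 = \<rho>0 * (\<rho>0 - \<rho>1 S (Suc 0))"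
    using \<rho>1_Suc[of 0] boundary(1) N1 by (simp add: \<phi>_def algebra_simps)
  moreover have "\<bar>\<rho>0 * (\<rho>0 - \<rho>1 S (Suc 0))\<bar> \<le> 1 * (N1 * D * c)"
    unfolding abs_mult using \<rho>1_near[of "Suc 0"] N1 \<rho>0 by (intro mult_mono) auto
  ultimately show ?thesis by simp
qed

section \<open>Comparison of the flow with that of the limiting profile\<close>

definition y where "y m = \<rho>_star c0 \<rho>0 (real m / real N2)"
text \<open>Flows are compared rather than densities because \<open>j2\<close> changes by only
  \<open>O(c)\<close> per step, even in the layer where \<open>x\<close> falls to 0.\<close>

definition E where "E m = j2 S m - \<phi> (y m)"
text \<open>The minimum of the derivative of \<open>\<phi>\<close> on
  \<open>[0, \<rho>0]\<close>.\<close>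

definition \<kappa> where "\<kappa> = 1 - 2 * \<rho>0"

lemma \<kappa>: "0 < \<kappa>" "\<kappa> \<le> 1" using \<rho>0 by (auto simp: \<kappa>_def)

lemma y_bounds: "0 < y m" "y m \<le> \<rho>0"
  using \<rho>_star_props[OF \<rho>0, of c0] c0 by (auto simp: y_def)

lemma y_Suc:
  "0 \<le> \<phi> (y m) - \<phi> (y (Suc m))" "\<phi> (y m) - \<phi> (y (Suc m)) \<le> c"
  "\<bar>\<phi> (y m) - \<phi> (y (Suc m)) - c * \<rho>0 * y m\<bar> \<le> c\<^sup>2 / \<kappa>"
proof -
  have h: "c0 * \<rho>0 * (real (Suc m) / real N2 - real m / real N2) = c * \<rho>0"
    using N2_pos c by (simp add: field_simps)
  have less: "real m / real N2 < real (Suc m) / real N2"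
    using N2_pos by (simp add: divide_strict_right_mono)
  have *: "0 \<le> \<phi> (y m) - \<phi> (y (Suc m))" "\<phi> (y m) - \<phi> (y (Suc m)) \<le> c * \<rho>0"
    "\<bar>\<phi> (y m) - \<phi> (y (Suc m)) - c * \<rho>0 * y m\<bar> \<le> c * \<rho>0 * (c * \<rho>0 / \<kappa>)"
    using \<rho>_star_increment[OF \<rho>0 c0 _ less] unfolding h y_def[symmetric] \<kappa>_def[symmetric]
    by simp_all
  have **: "c * \<rho>0 \<le> c" using \<rho>0 c_pos by simp
  then have "c * \<rho>0 * (c * \<rho>0 / \<kappa>) \<le> c * (c / \<kappa>)"
    using \<rho>0 c_pos \<kappa> by (intro mult_mono divide_right_mono) auto
  with * ** show "0 \<le> \<phi> (y m) - \<phi> (y (Suc m))" "\<phi> (y m) - \<phi> (y (Suc m)) \<le> c"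
    "\<bar>\<phi> (y m) - \<phi> (y (Suc m)) - c * \<rho>0 * y m\<bar> \<le> c\<^sup>2 / \<kappa>"
    by (simp_all add: power2_eq_square)
qed

text \<open>\<open>E m - x m * d m\<close> equals \<open>\<phi> (x m) - \<phi> (y m)\<close>, and
  \<open>\<phi>\<close> has slope at least \<open>\<kappa>\<close>.\<close>

lemma x_near_y:
  assumes "m < N2 + N3"
  shows "\<bar>x m - y m\<bar> \<le> (\<bar>E m\<bar> + d m) / \<kappa>"
proof -
  have xb: "0 \<le> x m" "x m \<le> \<rho>0" and d: "0 < d m" using x_bounds[of m] d_pos assms by auto
  define p where "p = x m * d m"
  have "E m - p = (x m - y m) * (1 - x m - y m)"
    using x_Suc[OF assms] by (simp add: E_def \<phi>_def p_def algebra_simps)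
  then have "\<bar>x m - y m\<bar> * \<bar>1 - x m - y m\<bar> = \<bar>E m - p\<bar>"
    by (simp add: abs_mult)
  moreover have "\<bar>x m - y m\<bar> * \<kappa> \<le> \<bar>x m - y m\<bar> * \<bar>1 - x m - y m\<bar>"
    using xb y_bounds[of m] by (intro mult_left_mono) (auto simp: \<kappa>_def)
  moreover have "\<bar>E m - p\<bar> \<le> \<bar>E m\<bar> + d m"
  proof -
    have "p \<le> d m" "0 \<le> p"
      unfolding p_def using xb d \<rho>0 by (intro mult_left_le_one_le mult_nonneg_nonneg; simp)+
    then show ?thesis by (simp only: abs_le_iff) linarith
  qed
  ultimately have "\<bar>x m - y m\<bar> * \<kappa> \<le> \<bar>E m\<bar> + d m" by linarith
  then show ?thesis using \<kappa> by (simp add: pos_le_divide_eq)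
qed

text \<open>With \<open>m + 2 < N2\<close> all three values of \<open>R\<close> lie on the plateau
  \<open>c * \<rho>end + O(c\<^sup>2)\<close>, and \<open>\<rho>end\<close> is
  \<open>\<rho>0 + O(c)\<close>.\<close>

lemma \<delta>_near:
  assumes "m + 2 < N2"
  shows "\<bar>\<delta> m - c * \<rho>0 * x m\<bar> \<le> (N1 * D + 2) * c\<^sup>2"
proof -
  have xb: "0 \<le> x m" "x m \<le> 1" "0 \<le> x (Suc m)" "x (Suc m) \<le> 1"
    using x_bounds[of m] x_bounds[of "Suc m"] assms \<rho>0 by auto
  have "\<bar>c * \<rho>end - c * \<rho>0\<bar> = c * \<bar>\<rho>end - \<rho>0\<bar>"
    using c_pos by (simp add: abs_mult flip: right_diff_distrib)
  also have "\<dots> \<le> c * (N1 * D * c)"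
    using c_pos \<rho>1_near[of N1] by (intro mult_left_mono) auto
  finally have "\<bar>R S (Suc m) - c * \<rho>0\<bar> \<le> c\<^sup>2 + c * (N1 * D * c)"
    using R_plateau[of "Suc m"] assms zero_le_power2[of c] by linarith
  then have 1: "\<bar>(R S (Suc m) - c * \<rho>0) * x m\<bar> \<le> (c\<^sup>2 + c * (N1 * D * c)) * 1"
    unfolding abs_mult using xb by (intro mult_mono) auto
  have "\<bar>R S m - R S (Suc (Suc m))\<bar> \<le> c\<^sup>2"
    using R_plateau[of m] R_plateau[of "Suc (Suc m)"] R_step2[of m] assms by simp
  then have 2: "\<bar>(R S m - R S (Suc (Suc m))) * x (Suc m)\<bar> \<le> c\<^sup>2 * 1"
    unfolding abs_mult using xb by (intro mult_mono) auto
  have "\<delta> m - c * \<rho>0 * x m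
      = (R S (Suc m) - c * \<rho>0) * x m + (R S m - R S (Suc (Suc m))) * x (Suc m)"
    by (simp add: \<delta>_def algebra_simps)
  then show ?thesis using 1 2 by (simp add: algebra_simps power2_eq_square)
qed

section \<open>Discrete Gronwall estimate for \<open>E\<close>\<close>

definition L where "L = 1 / \<kappa> + 2 / q"
text \<open>Collects the \<open>c\<^sup>2\<close> terms: \<open>Q / \<kappa>\<close> from
  \<open>d_le'\<close>, \<open>1 / \<kappa>\<close> from \<open>y_Suc\<close>, the rest from
  \<open>\<delta>_near\<close>.\<close>

definition B where "B = (Q + 1) / \<kappa> + N1 * D + 2"

lemma L_pos: "0 < L" and B_pos: "0 < B"
  using \<kappa> q Q D_pos by (auto simp: L_def B_def intro!: add_pos_pos add_nonneg_pos divide_nonneg_pos)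

text \<open>At the last two positions the increment of \<open>E\<close> is only \<open>O(c)\<close>; the factor \<open>2 / q\<close> in \<open>L\<close>
  lets the boundary layer term absorb it.\<close>

lemma E_step:
  assumes "m < N2" "Suc m < N2 + N3"
  shows "\<bar>E (Suc m)\<bar> \<le> (1 + c / \<kappa>) * \<bar>E m\<bar> + L * c * q ^ (N2 - 1 - m) + B * c\<^sup>2"
proof (cases "m + 2 < N2")
  case True
  \<comment> \<open>The first two brackets are consistency errors of order \<open>c\<^sup>2\<close>;
    the last is the feedback of the density error, which \<open>x_near_y\<close> bounds through
    \<open>E m\<close> and \<open>d m\<close>.\<close>
  have E: "E (Suc m) - E m = (\<phi> (y m) - \<phi> (y (Suc m)) - c * \<rho>0 * y m)
      - (\<delta> m - c * \<rho>0 * x m) - c * \<rho>0 * (x m - y m)"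
    using j2_Suc[OF assms(2)] by (simp add: E_def algebra_simps)
  have "\<bar>c * \<rho>0 * (x m - y m)\<bar> \<le> c * \<bar>x m - y m\<bar>"
    unfolding abs_mult using c_pos \<rho>0 by (intro mult_right_mono) auto
  also have "\<dots> \<le> c * ((\<bar>E m\<bar> + (q ^ (N2 - 1 - m) + Q * c)) / \<kappa>)"
  proof (rule mult_left_mono)
    have "(\<bar>E m\<bar> + d m) / \<kappa> \<le> (\<bar>E m\<bar> + (q ^ (N2 - 1 - m) + Q * c)) / \<kappa>"
      using d_le'[of m] assms \<kappa> by (intro divide_right_mono) auto
    then show "\<bar>x m - y m\<bar> \<le> (\<bar>E m\<bar> + (q ^ (N2 - 1 - m) + Q * c)) / \<kappa>"
      using x_near_y[of m] assms by linarith
  qed (use c_pos in simp)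
  finally have "\<bar>E (Suc m)\<bar> \<le> \<bar>E m\<bar> + c\<^sup>2 / \<kappa> + (N1 * D + 2) * c\<^sup>2
      + c * ((\<bar>E m\<bar> + (q ^ (N2 - 1 - m) + Q * c)) / \<kappa>)"
    using E y_Suc(3)[of m] \<delta>_near[OF True] by linarith
  also have "\<dots> = (1 + c / \<kappa>) * \<bar>E m\<bar> + 1 / \<kappa> * c * q ^ (N2 - 1 - m) + B * c\<^sup>2"
    by (simp add: B_def add_divide_distrib algebra_simps power2_eq_square)
  also have "\<dots> \<le> (1 + c / \<kappa>) * \<bar>E m\<bar> + L * c * q ^ (N2 - 1 - m) + B * c\<^sup>2"
    using q c_pos by (intro add_mono order_refl mult_right_mono) (auto simp: L_def)
  finally show ?thesis .
next
  case False
  have "\<bar>E (Suc m)\<bar> \<le> \<bar>E m\<bar> + 2 * c"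
    using j2_Suc[OF assms(2)] \<delta>_bounds[OF assms(2)] y_Suc(1,2)[of m] c_pos
    unfolding E_def by linarith
  moreover have "2 * c \<le> L * c * q ^ (N2 - 1 - m)"
  proof -
    \<comment> \<open>Here \<open>m + 2 \<ge> N2\<close>, so the exponent is 0 or 1.\<close>
    have "q ^ 1 \<le> q ^ (N2 - 1 - m)" using False q by (intro power_decreasing) auto
    then have "(2 / q) * c * q \<le> L * c * q ^ (N2 - 1 - m)"
      using q c_pos \<kappa> L_pos by (intro mult_mono) (auto simp: L_def)
    then show ?thesis using q by simp
  qed
  moreover have "0 \<le> c / \<kappa> * \<bar>E m\<bar>" "0 \<le> B * c\<^sup>2"
    using c_pos \<kappa> B_pos by (auto intro!: mult_nonneg_nonneg)
  ultimately show ?thesis by (simp add: algebra_simps)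
qed

definition A where "A = N1 * D + D"

text \<open>The profile starts at \<open>\<rho>0\<close>. The error consists of \<open>d 0\<close>,
  the variation of \<open>\<rho>1\<close> and the factor \<open>1 - c\<close> at the
  junction.\<close>

lemma E_0: "\<bar>E 0\<bar> \<le> A * c"
proof -
  have xb: "0 \<le> x 0" "x 0 \<le> \<rho>0" and d: "0 < d 0" using x_bounds[of 0] d_pos[of 0] N2_pos by auto
  define p where "p = x 0 * d 0"
  define r where "r = (\<rho>0 - x 0) * (1 - x 0 - \<rho>0)"
  have "E 0 = p - r"
    using x_Suc[of 0] N2_pos \<rho>_star_0[OF \<rho>0, of c0]
    by (simp add: E_def y_def \<phi>_def p_def r_def algebra_simps)
  moreover have "p \<le> d 0" "0 \<le> p"
    unfolding p_def using xb d \<rho>0 by (intro mult_left_le_one_le mult_nonneg_nonneg; simp)+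
  moreover have "r \<le> \<rho>0 - x 0" "0 \<le> r"
    unfolding r_def using xb \<rho>0 by (intro mult_right_le_one_le mult_nonneg_nonneg; simp)+
  ultimately have "\<bar>E 0\<bar> \<le> d 0 + (\<rho>0 - x 0)" by linarith
  moreover have "\<rho>0 - x 0 \<le> N1 * D * c + c"
  proof -
    have "c * \<rho>end \<le> c" using \<rho>end \<rho>0 c_pos by simp
    then show ?thesis using boundary(3) \<rho>1_near[of N1] by (simp add: algebra_simps)
  qed
  moreover have "d 0 + c \<le> D * c" using d_0_le c_pos by (simp add: D_def algebra_simps)
  ultimately show ?thesis by (simp add: A_def algebra_simps)
qed

text \<open>The last summand is a closed bound for the accumulated layer terms: one step turns
  \<open>q ^ (N2 - m)\<close> into \<open>q * ?p\<close> and adds \<open>L * c * ?p\<close>, and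
  \<open>q * Q + 1 = Q\<close> closes the induction.\<close>

lemma E_induct:
  "m \<le> N2 \<Longrightarrow> m < N2 + N3 \<Longrightarrow>
    \<bar>E m\<bar> \<le> (1 + c / \<kappa>) ^ m * (A * c + m * (B * c\<^sup>2) + L * Q * c * q ^ (N2 - m))"
proof (induction m)
  case 0
  have "0 \<le> L * Q * c * q ^ N2" using L_pos Q c_pos q by simp
  then show ?case using E_0 by simp
next
  case (Suc m)
  let ?g = "1 + c / \<kappa>" and ?p = "q ^ (N2 - 1 - m)"
  have g: "1 \<le> ?g ^ Suc m" using c_pos \<kappa> by (intro one_le_power) simp
  have p: "q ^ (N2 - m) = q * ?p" using Suc.prems by (intro q_power_shift) simp
  have n: "0 \<le> L * c * ?p + B * c\<^sup>2" using L_pos B_pos c_pos q by simp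
  have "\<bar>E (Suc m)\<bar> \<le> ?g * \<bar>E m\<bar> + (L * c * ?p + B * c\<^sup>2)"
    using E_step[of m] Suc.prems by (simp add: algebra_simps)
  also have "\<dots> \<le> ?g * (?g ^ m * (A * c + m * (B * c\<^sup>2) + L * Q * c * q ^ (N2 - m)))
      + ?g ^ Suc m * (L * c * ?p + B * c\<^sup>2)"
    using Suc c_pos \<kappa> mult_right_mono[OF g n] by (intro add_mono mult_left_mono) auto
  also have "\<dots> = ?g ^ Suc m * (A * c + Suc m * (B * c\<^sup>2) + L * (q * Q + 1) * c * ?p)"
    unfolding p by (simp add: algebra_simps)
  finally show ?case using Q(2) by simp
qed

definition K where "K = exp (c0 / \<kappa>) * (A + B * c0 + L * Q)"

text \<open>As \<open>m \<le> N2\<close> and \<open>c * real N2 = c0\<close>, the growth factor is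
  at most \<open>exp (c0 / \<kappa>)\<close> and \<open>m\<close> errors of order
  \<open>c\<^sup>2\<close> add up to \<open>O(c)\<close>. No logarithm appears.\<close>

lemma E_le:
  assumes "m \<le> N2" "m < N2 + N3"
  shows "\<bar>E m\<bar> \<le> K * c"
proof -
  have "(1 + c / \<kappa>) ^ m \<le> exp (c / \<kappa>) ^ m"
    using c_pos \<kappa> by (intro power_mono exp_ge_add_one_self) auto
  also have "\<dots> \<le> exp (c / \<kappa>) ^ N2"
    using c_pos \<kappa> assms by (intro power_increasing) auto
  also have "\<dots> = exp (c0 / \<kappa>)" using c_N2 by (simp add: mult.commute flip: exp_of_nat_mult)
  finally have g: "(1 + c / \<kappa>) ^ m \<le> exp (c0 / \<kappa>)" .
  have "real m * (B * c\<^sup>2) \<le> real N2 * (B * c\<^sup>2)"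
    using assms B_pos by (intro mult_right_mono) auto
  also have "\<dots> = B * c0 * c" by (simp add: power2_eq_square flip: c_N2)
  finally have "real m * (B * c\<^sup>2) \<le> B * c0 * c" .
  moreover have "L * Q * c * q ^ (N2 - m) \<le> L * Q * c"
    using L_pos Q c_pos q by (intro mult_right_le_one_le power_le_one) auto
  ultimately have "A * c + m * (B * c\<^sup>2) + L * Q * c * q ^ (N2 - m) \<le> (A + B * c0 + L * Q) * c"
    by (simp add: algebra_simps)
  moreover have "0 \<le> A * c + m * (B * c\<^sup>2) + L * Q * c * q ^ (N2 - m)"
    using D_pos c_pos B_pos L_pos Q q by (simp add: A_def)
  ultimately have "(1 + c / \<kappa>) ^ m * (A * c + m * (B * c\<^sup>2) + L * Q * c * q ^ (N2 - m))
      \<le> exp (c0 / \<kappa>) * ((A + B * c0 + L * Q) * c)"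
    using g by (intro mult_mono) auto
  then show ?thesis using E_induct[OF assms] by (simp add: K_def mult.assoc)
qed

section \<open>The density away from the exit, and the exit flow\<close>

lemma \<rho>2_near:
  assumes "real m \<le> real N2 - ln (real N2) / ln (1 / \<rho>0 - 1)" "1 < N2"
  shows "\<bar>x m - y m\<bar> \<le> (K + 1 / (q * c0) + Q) / \<kappa> * c"
proof -
  \<comment> \<open>Thus the range of \<open>m\<close> is exactly the one on which
    \<open>q ^ (N2 - m) \<le> 1 / real N2\<close>.\<close>
  have q': "1 / \<rho>0 - 1 = 1 / q" using \<rho>0 by (simp add: q_def field_simps)
  have lq: "0 < ln (1 / q)" using q by simp
  have "0 < ln (real N2)" using assms by simp
  then have "0 < ln (real N2) / ln (1 / q)" using lq by simp
  then have m: "m < N2" using assms q' by simp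
  have "ln (real N2) \<le> ln (1 / q) * real (N2 - m)"
    using assms(1) lq m unfolding q' by (simp add: field_simps of_nat_diff)
  also have "\<dots> = ln ((1 / q) ^ (N2 - m))" using q by (simp add: ln_realpow)
  finally have "real N2 \<le> (1 / q) ^ (N2 - m)" using N2_pos q by simp
  then have "q ^ (N2 - m) \<le> 1 / real N2"
    using q N2_pos by (simp add: power_one_over field_simps)
  \<comment> \<open>The exponent in \<open>d_le'\<close> is smaller by one, which costs the factor
    \<open>1 / q\<close>.\<close>
  moreover have "q ^ (N2 - m) = q * q ^ (N2 - 1 - m)" using m by (rule q_power_shift)
  ultimately have "q ^ (N2 - 1 - m) * q \<le> 1 / real N2"
    by (simp add: mult.commute)
  then have "q ^ (N2 - 1 - m) \<le> 1 / real N2 / q"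
    using pos_le_divide_eq[OF q(1)] by blast
  also have "\<dots> = 1 / (q * c0) * c" using c c0 by simp
  finally have "q ^ (N2 - 1 - m) \<le> 1 / (q * c0) * c" .
  then have "\<bar>E m\<bar> + d m \<le> (K + 1 / (q * c0) + Q) * c"
    using E_le[of m] d_le'[of m] m by (simp add: algebra_simps)
  then have "(\<bar>E m\<bar> + d m) / \<kappa> \<le> (K + 1 / (q * c0) + Q) * c / \<kappa>"
    using \<kappa> by (intro divide_right_mono) auto
  then show ?thesis using x_near_y[of m] m by simp
qed

text \<open>The exit flow is the last \<open>j2\<close>. For \<open>N3 = 0\<close> its index is
  \<open>N2 - 1\<close>, and moving the profile to \<open>N2\<close> costs one more
  \<open>c\<close>; otherwise \<open>R\<close> vanishes from \<open>N2\<close> on, so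
  \<open>j2\<close> stays constant up to the exit.\<close>

lemma exit_flow_near: "\<bar>exit_flow N2 N3 S - \<phi> (y N2)\<bar> \<le> (K + 1) * c"
proof -
  define M where "M = N2 + N3 - 1"
  have M: "M < N2 + N3" "Suc M = N2 + N3" using N2_pos by (auto simp: M_def)
  have ex: "exit_flow N2 N3 S = j2 S M"
    using exit_flow_eq[OF stationary] N2_pos x_Suc[OF M(1)] boundary(6) M by (simp add: M_def)
  show ?thesis
  proof (cases "N3 = 0")
    case True
    then have "M \<le> N2" "Suc M = N2" using M by auto
    then show ?thesis
      using E_le[of M] y_Suc(1,2)[of M] M unfolding ex E_def by (simp add: algebra_simps)
  next
    case False
    then have "N2 \<le> M" by (simp add: M_def)
    moreover have "j2 S m = j2 S N2" if "N2 \<le> m" "m \<le> M" for m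
      using that
    proof (induction rule: dec_induct)
      case (step m)
      then have "\<delta> m = 0" using M R_beyond by (simp add: \<delta>_def)
      then show ?case using step j2_Suc[of m] M by simp
    qed simp
    ultimately have "j2 S M = j2 S N2" by blast
    then show ?thesis
      using E_le[of N2] False c_pos unfolding ex E_def by (simp add: algebra_simps)
  qed
qed

end

section \<open>Passage to the asymptotic statements\<close>

theorem theorem3p2:
  fixes N1 N3 :: nat and c0 \<rho>0 :: real and S :: "nat \<Rightarrow> stationary_state"
  assumes "N1 \<ge> 1" and "c0 > 0" and "0 < \<rho>0" and "\<rho>0 < 1 / 2"
    and "\<And>N2. real N2 > c0 \<Longrightarrow> stationary_solution N1 N2 N3 \<rho>0 (c0 / real N2) (S N2)"
    and "\<And>N2. real N2 > c0 \<Longrightarrow> positive_solution N1 N2 N3 (S N2)"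
    and "\<And>N2. real N2 > c0 \<Longrightarrow> decreasing_solution N1 N2 N3 (S N2)"
  shows
    "(\<exists>C. \<forall>\<^sub>F N2 in sequentially. \<forall>n\<le>N1.
        \<bar>\<rho>1 (S N2) n - \<rho>0\<bar> \<le> C * (1 / real N2)) \<and>
     (\<exists>C. \<forall>\<^sub>F N2 in sequentially. \<forall>m.
        real m \<le> real N2 - ln (real N2) / ln (1 / \<rho>0 - 1) \<longrightarrow>
        \<bar>\<rho>2 (S N2) m - \<rho>_star c0 \<rho>0 (real m / real N2)\<bar> \<le> C * (1 / real N2)) \<and>
     (\<exists>C. \<forall>\<^sub>F N2 in sequentially.
        \<bar>j1 (S N2) - \<phi> \<rho>0\<bar> \<le> C * (1 / real N2)) \<and>
     (\<exists>C. \<forall>\<^sub>F N2 in sequentially. \<forall>m.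
        m \<le> N2 \<and> m < N2 + N3 \<longrightarrow>
        \<bar>j2 (S N2) m - \<phi> (\<rho>_star c0 \<rho>0 (real m / real N2))\<bar> \<le> C * (ln (real N2) / real N2)) \<and>
     (\<exists>C. \<forall>\<^sub>F N2 in sequentially.
        \<bar>exit_flow N2 N3 (S N2) - \<phi> (\<rho>_star c0 \<rho>0 1)\<bar> \<le> C * (ln (real N2) / real N2))"
proof -
  \<comment> \<open>\<open>exp 1 \<le> real N2\<close> serves the logarithmic rates,
    \<open>1 < N2\<close> serves \<open>\<rho>2_near\<close>.\<close>
  have large: "\<forall>\<^sub>F N2 in sequentially. c0 < real N2 \<and> exp 1 \<le> real N2 \<and> 1 < N2"
    by (intro eventually_conj eventually_gt_at_top
        filterlim_real_sequentially[THEN filterlim_at_top_dense[THEN iffD1], rule_format]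
        filterlim_real_sequentially[THEN filterlim_at_top[THEN iffD1], rule_format])
  have profile: "decreasing_profile N1 N2 N3 c0 (c0 / real N2) \<rho>0 (S N2)" if "c0 < real N2" for N2
    using assms that by unfold_locales auto
  note defs = decreasing_profile.y_def[OF profile] decreasing_profile.E_def[OF profile]
  let ?D = "N1 * decreasing_profile.D c0 \<rho>0"
  let ?q = "decreasing_profile.q \<rho>0" and ?Q = "decreasing_profile.Q \<rho>0"
    and ?\<kappa> = "decreasing_profile.\<kappa> \<rho>0" and ?K = "decreasing_profile.K N1 c0 \<rho>0"
  \<comment> \<open>Passes from rate \<open>1 / N2\<close> to the stated \<open>ln N2 / N2\<close>;
    \<open>0 \<le> b\<close> gives the sign of \<open>C * (c0 / real N2)\<close>.\<close>
  have weaken: "b \<le> C * c0 * (ln (real N2) / real N2)"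
    if "0 \<le> b" "b \<le> C * (c0 / real N2)" "exp 1 \<le> real N2" for b C N2
  proof -
    have "1 \<le> ln (real N2)"
      using that(3) by (metis exp_gt_zero ln_exp ln_mono order_less_le_trans)
    then have "C * (c0 / real N2) * 1 \<le> C * (c0 / real N2) * ln (real N2)"
      using that by (intro mult_left_mono) auto
    then show ?thesis using that by simp
  qed
  show ?thesis
  proof (intro conjI)
    show "\<exists>C. \<forall>\<^sub>F N2 in sequentially. \<forall>n\<le>N1. \<bar>\<rho>1 (S N2) n - \<rho>0\<bar> \<le> C * (1 / real N2)"
      using large
      by (intro exI[of _ "?D * c0"]) (elim eventually_mono, use decreasing_profile.\<rho>1_near[OF profile] in auto)
    show "\<exists>C. \<forall>\<^sub>F N2 in sequentially. \<forall>m.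
        real m \<le> real N2 - ln (real N2) / ln (1 / \<rho>0 - 1) \<longrightarrow>
        \<bar>\<rho>2 (S N2) m - \<rho>_star c0 \<rho>0 (real m / real N2)\<bar> \<le> C * (1 / real N2)"
      using large
      by (intro exI[of _ "(?K + 1 / (?q * c0) + ?Q) / ?\<kappa> * c0"])
        (elim eventually_mono, use decreasing_profile.\<rho>2_near[OF profile] in \<open>auto simp: defs\<close>)
    show "\<exists>C. \<forall>\<^sub>F N2 in sequentially. \<bar>j1 (S N2) - \<phi> \<rho>0\<bar> \<le> C * (1 / real N2)"
      using large
      by (intro exI[of _ "?D * c0"]) (elim eventually_mono, use decreasing_profile.j1_near[OF profile] in auto)
    show "\<exists>C. \<forall>\<^sub>F N2 in sequentially. \<forall>m. m \<le> N2 \<and> m < N2 + N3 \<longrightarrow>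
        \<bar>j2 (S N2) m - \<phi> (\<rho>_star c0 \<rho>0 (real m / real N2))\<bar> \<le> C * (ln (real N2) / real N2)"
      using large
    proof (intro exI, elim eventually_mono, intro allI impI)
      fix N2 m assume "c0 < real N2 \<and> exp 1 \<le> real N2 \<and> 1 < N2" "m \<le> N2 \<and> m < N2 + N3"
      then show "\<bar>j2 (S N2) m - \<phi> (\<rho>_star c0 \<rho>0 (real m / real N2))\<bar>
          \<le> ?K * c0 * (ln (real N2) / real N2)"
        using decreasing_profile.E_le[OF profile, of N2 m] by (intro weaken) (auto simp: defs)
    qed
    show "\<exists>C. \<forall>\<^sub>F N2 in sequentially.
        \<bar>exit_flow N2 N3 (S N2) - \<phi> (\<rho>_star c0 \<rho>0 1)\<bar> \<le> C * (ln (real N2) / real N2)"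
      using large
    proof (intro exI, elim eventually_mono)
      fix N2 assume "c0 < real N2 \<and> exp 1 \<le> real N2 \<and> 1 < N2"
      then show "\<bar>exit_flow N2 N3 (S N2) - \<phi> (\<rho>_star c0 \<rho>0 1)\<bar>
          \<le> (?K + 1) * c0 * (ln (real N2) / real N2)"
        using decreasing_profile.exit_flow_near[OF profile, of N2] by (intro weaken) (auto simp: defs)
    qed
  qed
qed

end
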